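(* Let $\mathcal R:\mathbb R^n\to\mathbb R\cup\{+\infty\}$ be invariant under coordinate permutations and suppose that, in addition, at least one of the following holds: (1) $\mathrm{dom}(\mathcal R)\subseteq\mathbb R_+^n$; or (2) $\mathcal R$ is invariant under coordinate-wise sign changes. Let $s\le r\le n$, and fix $y\in\mathbb R^n$ and $\lambda>0$. If $\mathrm{dom}(\mathcal R)\subseteq\mathbb R_+^n$, let $T$ contain the indices of the $r$ largest entries of $y$. If $\mathcal R$ is invariant under coordinate-wise sign changes, let $T$ contain the indices of the $r$ largest entries of $y$ in absolute value. Let $$\widehat u\in\arg\min_{u\in\mathbb R^r}\left\{\lambda\|u-y_T\|^2+\mathcal R(I_Tu)\right\},\qquad \widehat x:=I_T\widehat u.$$ Then $$\widehat x\in\arg\min_{x\in\mathcal C_r}\left\{\lambda\|x-y\|^2+\mathcal R(x)\right\}.$$ Consequently, if every $x^*\in\mathcal X^*$ is $s$-sparse, then for every $r\ge s$ this construction implements a weak proximal oracle.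
   Context: Setting: minimize $F(x)=f(x)+\mathcal R(x)$ over $x\in\mathbb R^n$, with $f:\mathbb R^n\to\mathbb R$ closed and convex, $\mathcal R$ proper, closed and convex, and $\mathcal X^*:=\arg\min F$ nonempty. It is also a standing assumption that, for some $\alpha>0$, $F(x)-\min F\ge\frac\alpha2\mathrm{dist}(x,\mathcal X^* )^2$ for all $x\in\mathrm{dom}(\mathcal R)$. Norms are Euclidean. Notation: $\mathrm{nnz}(x)$ is the number of nonzero entries of $x$; $x$ is $s$-sparse if $\mathrm{nnz}(x)\le s$; $\mathcal C_r:=\{x\in\mathrm{dom}(\mathcal R):\mathrm{nnz}(x)\le r\}$. For $T\subseteq[n]$ with $|T|=r$, $I_T\in\mathbb R^{n\times r}$ is the matrix formed by the columns of the $n\times n$ identity matrix indexed by $T$, and $y_T\in\mathbb R^r$ is the restriction of $y$ to $T$. ($T$ has exactly $r$ elements, ties broken arbitrarily.) Weak proximal oracle: a map $\mathcal A:\mathbb R^n\times\mathbb R_+\to\mathrm{dom}(\mathcal R)$ such that for every $y\in\mathbb R^n$ and $\lambda>0$, the output $x=\mathcal A(y,\lambda)$ satisfies $\lambda\|x-y\|^2+\mathcal R(x)\le\lambda\|x^*-y\|^2+\mathcal R(x^* )$ for all $x^*\in\mathcal X^*$. *)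

theory Defs
  imports "HOL-Analysis.Analysis"
begin

definition edom :: "('a \<Rightarrow> ereal) \<Rightarrow> 'a set" where
  "edom g = {x. g x < \<infinity>}"

definition ereal_epigraph :: "('a \<Rightarrow> ereal) \<Rightarrow> ('a \<times> real) set" where
  "ereal_epigraph g = {(x, t). g x \<le> ereal t}"

(* Codomain R \<union> {+\<infinity>} and not identically +\<infinity>. *)
definition proper_fun :: "('a \<Rightarrow> ereal) \<Rightarrow> bool" where
  "proper_fun g \<longleftrightarrow> (\<forall>x. g x \<noteq> -\<infinity>) \<and> (\<exists>x. g x \<noteq> \<infinity>)"

(* A minimizer must have a value below +\<infinity>; in particular the argmin is empty
   if g is identically +\<infinity> on S. *)
definition argmin_on :: "('a \<Rightarrow> ereal) \<Rightarrow> 'a set \<Rightarrow> 'a set" where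
  "argmin_on g S = {x. is_arg_min g (\<lambda>z. z \<in> S) x \<and> g x < \<infinity>}"

definition objective :: "(real^'n \<Rightarrow> real) \<Rightarrow> (real^'n \<Rightarrow> ereal) \<Rightarrow> real^'n \<Rightarrow> ereal" where
  "objective f R x = ereal (f x) + R x"

definition minimizers :: "(real^'n \<Rightarrow> real) \<Rightarrow> (real^'n \<Rightarrow> ereal) \<Rightarrow> (real^'n) set" where
  "minimizers f R = argmin_on (objective f R) UNIV"

definition quadratic_growth ::
    "(real^'n \<Rightarrow> real) \<Rightarrow> (real^'n \<Rightarrow> ereal) \<Rightarrow> real \<Rightarrow> bool" where
  "quadratic_growth f R \<alpha> \<longleftrightarrow>
     (\<forall>x\<in>edom R. objective f R x - (INF z. objective f R z)
        \<ge> ereal (\<alpha> / 2 * (infdist x (minimizers f R))\<^sup>2))"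

definition permutation_invariant :: "(real^'n \<Rightarrow> ereal) \<Rightarrow> bool" where
  "permutation_invariant R \<longleftrightarrow> (\<forall>p x. p permutes UNIV \<longrightarrow> R (\<chi> i. x $ p i) = R x)"

definition sign_invariant :: "(real^'n \<Rightarrow> ereal) \<Rightarrow> bool" where
  "sign_invariant R \<longleftrightarrow>
     (\<forall>\<sigma> x. (\<forall>i. \<sigma> i \<in> {-1, 1}) \<longrightarrow> R (\<chi> i. \<sigma> i * x $ i) = R x)"

definition nonneg_orthant :: "(real^'n) set" where
  "nonneg_orthant = {x. \<forall>i. 0 \<le> x $ i}"

definition nnz :: "real^'n \<Rightarrow> nat" where
  "nnz x = card {i. x $ i \<noteq> 0}"

definition sparse_dom :: "(real^'n \<Rightarrow> ereal) \<Rightarrow> nat \<Rightarrow> (real^'n) set" where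
  "sparse_dom R r = {x \<in> edom R. nnz x \<le> r}"

definition prox_objective ::
    "(real^'n \<Rightarrow> ereal) \<Rightarrow> real \<Rightarrow> real^'n \<Rightarrow> real^'n \<Rightarrow> ereal" where
  "prox_objective R lam y x = ereal (lam * (norm (x - y))\<^sup>2) + R x"

definition top_indices :: "nat \<Rightarrow> ('n::finite \<Rightarrow> real) \<Rightarrow> 'n set \<Rightarrow> bool" where
  "top_indices r w T \<longleftrightarrow> card T = r \<and> (\<forall>i\<in>T. \<forall>j\<in>-T. w j \<le> w i)"

(* If both structural conditions hold, either selection rule is admissible. *)
definition admissible_support ::
    "(real^'n \<Rightarrow> ereal) \<Rightarrow> nat \<Rightarrow> real^'n \<Rightarrow> 'n set \<Rightarrow> bool" where
  "admissible_support R r y T \<longleftrightarrow>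
     (edom R \<subseteq> nonneg_orthant \<and> top_indices r (\<lambda>i. y $ i) T) \<or>
     (sign_invariant R \<and> top_indices r (\<lambda>i. \<bar>y $ i\<bar>) T)"

(* The dimension r depends on a term and may be 0, so a vector of R^r is a function
   on {..<r}, and L2_set over {..<r} is its Euclidean norm. An index set T with r
   elements is listed by a bijection e from {..<r} to T; its order is immaterial. *)
definition vec_space :: "nat \<Rightarrow> (nat \<Rightarrow> real) set" where
  "vec_space r = {..<r} \<rightarrow>\<^sub>E UNIV"

(* The product I_T u: column k of I_T is column (e k) of the identity matrix. *)
definition embed_vec :: "nat \<Rightarrow> (nat \<Rightarrow> 'n::finite) \<Rightarrow> (nat \<Rightarrow> real) \<Rightarrow> real^'n" where
  "embed_vec r e u = (\<Sum>k<r. u k *\<^sub>R column (e k) (mat 1))"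

(* y_T is the vector with entries y $ e k, k < r. *)
definition restricted_objective ::
    "(real^'n \<Rightarrow> ereal) \<Rightarrow> real \<Rightarrow> nat \<Rightarrow> (nat \<Rightarrow> 'n) \<Rightarrow> real^'n \<Rightarrow> (nat \<Rightarrow> real) \<Rightarrow> ereal" where
  "restricted_objective R lam r e y u =
     ereal (lam * (L2_set (\<lambda>k. u k - y $ e k) {..<r})\<^sup>2) + R (embed_vec r e u)"

definition restricted_minimizers ::
    "(real^'n \<Rightarrow> ereal) \<Rightarrow> real \<Rightarrow> nat \<Rightarrow> (nat \<Rightarrow> 'n) \<Rightarrow> real^'n \<Rightarrow> (nat \<Rightarrow> real) set" where
  "restricted_minimizers R lam r e y = argmin_on (restricted_objective R lam r e y) (vec_space r)"

definition sparse_prox_output ::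
    "(real^'n \<Rightarrow> ereal) \<Rightarrow> nat \<Rightarrow> real^'n \<Rightarrow> real \<Rightarrow> real^'n \<Rightarrow> bool" where
  "sparse_prox_output R r y lam x \<longleftrightarrow>
     (\<exists>T e u. admissible_support R r y T \<and> bij_betw e {..<r} T \<and>
        u \<in> restricted_minimizers R lam r e y \<and> x = embed_vec r e u)"

(* The construction is only specified for positive parameters; at 0 a map into the
   domain of R is free to take any value there. *)
definition sparse_prox_map ::
    "(real^'n \<Rightarrow> ereal) \<Rightarrow> nat \<Rightarrow> (real^'n \<Rightarrow> real \<Rightarrow> real^'n) \<Rightarrow> bool" where
  "sparse_prox_map R r A \<longleftrightarrow>
     (\<forall>y. A y 0 \<in> edom R) \<and> (\<forall>y lam. 0 < lam \<longrightarrow> sparse_prox_output R r y lam (A y lam))"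

definition weak_proximal_oracle ::
    "(real^'n \<Rightarrow> real) \<Rightarrow> (real^'n \<Rightarrow> ereal) \<Rightarrow> (real^'n \<Rightarrow> real \<Rightarrow> real^'n) \<Rightarrow> bool" where
  "weak_proximal_oracle f R A \<longleftrightarrow>
     (\<forall>y lam. 0 \<le> lam \<longrightarrow> A y lam \<in> edom R) \<and>
     (\<forall>y lam. 0 < lam \<longrightarrow> (\<forall>x'\<in>minimizers f R.
        prox_objective R lam y (A y lam) \<le> prox_objective R lam y x'))"

end

theory Submission
  imports Defs
begin

text \<open>
  Exchange argument: moving a nonnegative coordinate of \<open>x\<close> from an index outside \<open>T\<close> to a vacant
  index of \<open>T\<close> changes neither the norm of \<open>x\<close> nor \<open>\<R>(x)\<close> and does not decrease the inner product
  with \<open>y\<close>, so every \<open>r\<close>-sparse point is dominated by one supported on \<open>T\<close>; under sign invariance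
  the argument is applied to absolute values.  On points supported on \<open>T\<close> the full and the
  restricted objective differ by a constant.  Restricted minimizers exist because a closed convex
  \<open>\<R>\<close> decreases at most linearly, which makes the proximal objective coercive.
\<close>

subsection \<open>Exchange of coordinates\<close>

text \<open>Induction on the number of nonzero entries outside \<open>T\<close>: each step swaps one
  of them into a vacant place of \<open>T\<close>, where the weight is at least as large. The result
  is phrased with a permutation \<open>p\<close>, so that permutation invariance of \<open>R\<close>
  and of the norm applies to it directly.\<close>

lemma exists_rearrangement_supported_on:
  fixes x w :: "'n::finite \<Rightarrow> real"
  assumes "top_indices r w T" and "\<And>i. 0 \<le> x i" and "card {i. x i \<noteq> 0} \<le> r"
  shows "\<exists>p. p permutes UNIV \<and> (\<forall>i. i \<notin> T \<longrightarrow> x (p i) = 0) \<and>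
    (\<Sum>i\<in>UNIV. x i * w i) \<le> (\<Sum>i\<in>UNIV. x (p i) * w i)"
  using assms
proof (induction "card ({i. x i \<noteq> 0} - T)" arbitrary: x)
  case 0
  then have "{i. x i \<noteq> 0} - T = {}"
    by simp
  then show ?case
    using permutes_id[of UNIV] by (intro exI[of _ "\<lambda>i. i"]) (auto simp: id_def)
next
  case (Suc k)
  let ?S = "{i. x i \<noteq> 0}"
  have cT: "card T = r" and top: "\<And>i j. i \<in> T \<Longrightarrow> j \<notin> T \<Longrightarrow> w j \<le> w i"
    using Suc.prems(1) by (auto simp: top_indices_def)
  have "card (?S - T) \<noteq> 0"
    using Suc.hyps(2) by linarith
  then have "?S - T \<noteq> {}"
    by (metis card.empty)
  then obtain a where a: "x a \<noteq> 0" "a \<notin> T"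
    by blast
  \<comment> \<open>Pigeonhole: if \<open>T\<close> were full, the support would contain the
    \<open>r + 1\<close> elements of \<open>insert a T\<close>.\<close>
  have "\<not> T \<subseteq> ?S"
  proof
    assume "T \<subseteq> ?S"
    then have "card (insert a T) \<le> card ?S"
      using a by (intro card_mono) auto
    then show False
      using a cT Suc.prems(3) by simp
  qed
  then obtain b where b: "b \<in> T" "x b = 0"
    by auto
  have ab: "a \<noteq> b"
    using a b by auto
  define t where "t = Transposition.transpose a b"
  have t: "t permutes UNIV"
    by (simp add: t_def permutes_swap_id)
  define z where "z i = x (t i)" for i
  have za: "z a = 0" "z b = x a" "\<And>i. i \<noteq> a \<Longrightarrow> i \<noteq> b \<Longrightarrow> z i = x i"
    using ab b by (auto simp: z_def t_def)
  have "{i. z i \<noteq> 0} - T = (?S - T) - {a}"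
    using za b(1) by (auto split: if_splits) (metis, metis)
  then have k: "k = card ({i. z i \<noteq> 0} - T)"
    using Suc.hyps(2) a by simp
  \<comment> \<open>The swap \<open>t\<close> is its own inverse, so the support of \<open>z\<close>
    is carried over from that of \<open>x\<close> and the bound \<open>r\<close> survives for the
    induction hypothesis.\<close>
  have "{i. z i \<noteq> 0} \<subseteq> t ` ?S"
  proof
    fix i assume "i \<in> {i. z i \<noteq> 0}"
    then show "i \<in> t ` ?S"
      by (intro image_eqI[of i t "t i"]) (auto simp: z_def t_def)
  qed
  then have cz: "card {i. z i \<noteq> 0} \<le> r"
    using Suc.prems(3) surj_card_le[of ?S "{i. z i \<noteq> 0}" t] by simp
  obtain p where p: "p permutes UNIV" "\<And>i. i \<notin> T \<Longrightarrow> z (p i) = 0"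
    and le: "(\<Sum>i\<in>UNIV. z i * w i) \<le> (\<Sum>i\<in>UNIV. z (p i) * w i)"
    using Suc.hyps(1)[OF k Suc.prems(1) _ cz] Suc.prems(2) by (auto simp: z_def)
  \<comment> \<open>Only the terms at \<open>a\<close> and \<open>b\<close> change under the swap:
    together they pass from \<open>x a * w a\<close> to \<open>x a * w b\<close>.\<close>
  have split: "(\<Sum>i\<in>UNIV. g i) = g a + g b + (\<Sum>i\<in>UNIV - {a} - {b}. g i)" for g :: "'n \<Rightarrow> real"
    using ab by (simp add: sum.remove[of UNIV a] sum.remove[of "UNIV - {a}" b])
  have "(\<Sum>i\<in>UNIV - {a} - {b}. x i * w i) = (\<Sum>i\<in>UNIV - {a} - {b}. z i * w i)"
    using za by (intro sum.cong) auto
  moreover have "x a * w a \<le> x a * w b"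
    using top[OF b(1) a(2)] Suc.prems(2) by (simp add: mult_left_mono)
  ultimately have "(\<Sum>i\<in>UNIV. x i * w i) \<le> (\<Sum>i\<in>UNIV. z i * w i)"
    using za b by (simp add: split)
  then show ?case
    using p le t by (intro exI[of _ "t \<circ> p"]) (auto simp: z_def permutes_compose)
qed

text \<open>In the expansion of the squared distance to \<open>y\<close>, only the inner product
  with \<open>y\<close> differs between \<open>x\<close> and \<open>z\<close>.\<close>

lemma norm_diff_mono_inner:
  fixes x y z :: "'a::real_inner"
  assumes "norm z = norm x" and "x \<bullet> y \<le> z \<bullet> y"
  shows "(norm (z - y))\<^sup>2 \<le> (norm (x - y))\<^sup>2"
proof -
  have "z \<bullet> z = x \<bullet> x"
    using assms(1) by (metis power2_norm_eq_inner)
  then show ?thesis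
    using assms(2) by (simp add: power2_norm_eq_inner inner_diff_left inner_diff_right inner_commute)
qed

lemma norm_vec_permute:
  fixes x :: "real^'n"
  assumes "p permutes UNIV"
  shows "norm (\<chi> i. x $ p i) = norm x"
  using sum.permute[OF assms, of "\<lambda>i. (x $ i)\<^sup>2"] by (simp add: norm_vec_def L2_set_def o_def)

lemma norm_vec_sign:
  fixes x :: "real^'n"
  assumes "\<And>i. \<sigma> i \<in> {-1, 1}"
  shows "norm (\<chi> i. \<sigma> i * x $ i) = norm x"
proof -
  have "\<bar>\<sigma> i\<bar> = 1" for i
    using assms[of i] by auto
  then show ?thesis
    by (simp add: norm_vec_def L2_set_def power_mult_distrib abs_mult)
qed

text \<open>Permutations and sign changes preserve both \<open>R\<close> and the norm, so it
  suffices to move \<open>x\<close> into \<open>T\<close> without decreasing its inner product with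
  \<open>y\<close>.\<close>

lemma exists_dominating_point_supported_on:
  fixes R :: "real^'n \<Rightarrow> ereal"
  assumes perm: "permutation_invariant R" and lam: "0 \<le> lam"
    and T: "admissible_support R r y T" and x: "x \<in> sparse_dom R r"
  shows "\<exists>z. (\<forall>i. i \<notin> T \<longrightarrow> z $ i = 0) \<and> R z = R x \<and>
    prox_objective R lam y z \<le> prox_objective R lam y x"
proof -
  have dom: "x \<in> edom R" and nnz: "card {i. x $ i \<noteq> 0} \<le> r"
    using x by (auto simp: sparse_dom_def nnz_def)
  have "\<exists>z. (\<forall>i. i \<notin> T \<longrightarrow> z $ i = 0) \<and> R z = R x \<and> norm z = norm x \<and> x \<bullet> y \<le> z \<bullet> y"
    using T unfolding admissible_support_def
  proof (elim disjE conjE)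
    assume sub: "edom R \<subseteq> nonneg_orthant" and top: "top_indices r (\<lambda>i. y $ i) T"
    have "0 \<le> x $ i" for i
      using dom sub by (auto simp: nonneg_orthant_def)
    then obtain p where "p permutes UNIV" "\<And>i. i \<notin> T \<Longrightarrow> x $ p i = 0"
      "(\<Sum>i\<in>UNIV. x $ i * y $ i) \<le> (\<Sum>i\<in>UNIV. x $ p i * y $ i)"
      using exists_rearrangement_supported_on[OF top, of "\<lambda>i. x $ i"] nnz by auto
    then show ?thesis
      using perm by (intro exI[of _ "\<chi> i. x $ p i"])
        (auto simp: permutation_invariant_def norm_vec_permute inner_vec_def)
  next
    assume sign: "sign_invariant R" and top: "top_indices r (\<lambda>i. \<bar>y $ i\<bar>) T"
    \<comment> \<open>Unlike the usual sign function, \<open>sg\<close> is 1 at 0, since sign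
      invariance admits only the factors -1 and 1.\<close>
    define sg :: "real \<Rightarrow> real" where "sg c = (if c < 0 then -1 else 1)" for c
    have sg: "sg c \<in> {-1, 1}" "sg c * c = \<bar>c\<bar>" for c
      by (auto simp: sg_def)
    define a where "a = (\<chi> i. sg (x $ i) * x $ i)"
    have a_abs: "a $ i = \<bar>x $ i\<bar>" for i
      by (simp add: a_def sg(2))
    have R_sign: "R (\<chi> i. sg (v $ i) * w $ i) = R w" for v w :: "real^'n"
      by (rule sign[unfolded sign_invariant_def, rule_format]) (rule sg(1))
    have norm_sign: "norm (\<chi> i. sg (v $ i) * w $ i) = norm w" for v w :: "real^'n"
      by (rule norm_vec_sign) (rule sg(1))
    have "R a = R x" and "norm a = norm x"
      unfolding a_def by (fact R_sign norm_sign)+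
    obtain p where p: "p permutes UNIV" "\<And>i. i \<notin> T \<Longrightarrow> a $ p i = 0"
      "(\<Sum>i\<in>UNIV. a $ i * \<bar>y $ i\<bar>) \<le> (\<Sum>i\<in>UNIV. a $ p i * \<bar>y $ i\<bar>)"
      using exists_rearrangement_supported_on[OF top, of "\<lambda>i. a $ i"] nnz by (auto simp: a_abs)
    \<comment> \<open>After stripping the signs of \<open>x\<close> (vector \<open>a\<close>) and
      rearranging (vector \<open>b\<close>), the signs of \<open>y\<close> are put on, which makes
      every term of \<open>z \<bullet> y\<close> equal to
      \<open>b $ i * \<bar>y $ i\<bar>\<close>.\<close>
    define b where "b = (\<chi> i. a $ p i)"
    define z where "z = (\<chi> i. sg (y $ i) * b $ i)"
    have "R z = R b" and "norm z = norm b"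
      unfolding z_def by (fact R_sign norm_sign)+
    moreover have "R b = R a" and "norm b = norm a"
      using perm p(1) by (auto simp: b_def permutation_invariant_def norm_vec_permute)
    moreover have "x \<bullet> y \<le> z \<bullet> y"
    proof -
      have "x \<bullet> y \<le> (\<Sum>i\<in>UNIV. a $ i * \<bar>y $ i\<bar>)"
        unfolding inner_vec_def a_abs
        by (intro sum_mono) (simp, metis abs_ge_self abs_mult)
      also have "\<dots> \<le> (\<Sum>i\<in>UNIV. a $ p i * \<bar>y $ i\<bar>)"
        by (fact p(3))
      also have "\<dots> = z \<bullet> y"
        unfolding inner_vec_def
        by (intro sum.cong) (simp_all add: z_def b_def sg(2)[symmetric] ac_simps)
      finally show ?thesis .
    qed
    ultimately show ?thesis
      using p(2) \<open>R a = R x\<close> \<open>norm a = norm x\<close>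
      by (intro exI[of _ z]) (auto simp: z_def b_def)
  qed
  then obtain z where z: "\<forall>i. i \<notin> T \<longrightarrow> z $ i = 0" "R z = R x" "norm z = norm x" "x \<bullet> y \<le> z \<bullet> y"
    by auto
  have "lam * (norm (z - y))\<^sup>2 \<le> lam * (norm (x - y))\<^sup>2"
    using norm_diff_mono_inner[OF z(3,4)] lam by (rule mult_left_mono)
  then have "prox_objective R lam y z \<le> prox_objective R lam y x"
    unfolding prox_objective_def z(2) by (intro add_right_mono) simp
  then show ?thesis
    using z by auto
qed

subsection \<open>Vectors supported on an index set\<close>

lemma embed_vec_nth:
  fixes e :: "nat \<Rightarrow> 'n::finite"
  assumes "bij_betw e {..<r} T"
  shows embed_vec_nth_inside: "k < r \<Longrightarrow> embed_vec r e u $ e k = u k"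
    and embed_vec_nth_outside: "i \<notin> T \<Longrightarrow> embed_vec r e u $ i = 0"
proof -
  have nth: "embed_vec r e u $ i = (\<Sum>k<r. if i = e k then u k else 0)" for i
    by (auto simp: embed_vec_def column_def mat_def intro!: sum.cong)
  show "i \<notin> T \<Longrightarrow> embed_vec r e u $ i = 0"
    using assms unfolding nth by (intro sum.neutral) (auto simp: bij_betw_def)
  assume k: "k < r"
  have "embed_vec r e u $ e k = (\<Sum>l<r. if l = k then u l else 0)"
    unfolding nth using assms k by (intro sum.cong) (auto simp: bij_betw_def inj_on_def)
  then show "embed_vec r e u $ e k = u k"
    using k by simp
qed

text \<open>Every vector supported on \<open>T\<close> is thus reached from coordinates in
  \<open>vec_space r\<close>; \<open>restrict\<close> is there because \<open>vec_space r\<close>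
  holds only functions that are \<open>undefined\<close> off \<open>{..<r}\<close>.\<close>

lemma embed_vec_restrict:
  fixes z :: "real^'n"
  assumes "bij_betw e {..<r} T" and "\<And>i. i \<notin> T \<Longrightarrow> z $ i = 0"
  shows "embed_vec r e (restrict (\<lambda>k. z $ e k) {..<r}) = z"
proof (rule vec_eq_iff[THEN iffD2], rule allI)
  fix i
  show "embed_vec r e (restrict (\<lambda>k. z $ e k) {..<r}) $ i = z $ i"
  proof (cases "i \<in> T")
    case True
    then obtain k where "k < r" "i = e k"
      using assms(1) by (auto simp: bij_betw_def)
    then show ?thesis
      using embed_vec_nth_inside[OF assms(1)] by simp
  next
    case False
    then show ?thesis
      using embed_vec_nth_outside[OF assms(1)] assms(2) by simp
  qed
qed

lemma nnz_embed_vec_le: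
  assumes "bij_betw e {..<r} T"
  shows "nnz (embed_vec r e u :: real^'n) \<le> r"
proof -
  have "{i. embed_vec r e u $ i \<noteq> 0} \<subseteq> T"
    using embed_vec_nth_outside[OF assms] by blast
  then have "nnz (embed_vec r e u) \<le> card T"
    unfolding nnz_def by (intro card_mono) auto
  then show ?thesis
    using bij_betw_same_card[OF assms] by simp
qed

text \<open>The embedded vector vanishes off \<open>T\<close>, so the coordinates there contribute
  the same squares of \<open>y\<close> whatever \<open>u\<close> is; \<open>e\<close> reindexes the
  remaining ones.\<close>

lemma prox_objective_embed_vec:
  fixes R :: "real^'n \<Rightarrow> ereal"
  assumes "bij_betw e {..<r} T"
  shows "prox_objective R lam y (embed_vec r e u) =
    ereal (lam * (\<Sum>i\<in>-T. (y $ i)\<^sup>2)) + restricted_objective R lam r e y u"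
proof -
  let ?v = "embed_vec r e u"
  have "(norm (?v - y))\<^sup>2 = (\<Sum>i\<in>UNIV. (?v $ i - y $ i)\<^sup>2)"
    by (simp add: norm_vec_def L2_set_def sum_nonneg)
  also have "\<dots> = (\<Sum>i\<in>T. (?v $ i - y $ i)\<^sup>2) + (\<Sum>i\<in>-T. (?v $ i - y $ i)\<^sup>2)"
    by (subst sum.union_disjoint[symmetric]) auto
  also have "(\<Sum>i\<in>-T. (?v $ i - y $ i)\<^sup>2) = (\<Sum>i\<in>-T. (y $ i)\<^sup>2)"
    using embed_vec_nth_outside[OF assms] by (intro sum.cong) auto
  also have "(\<Sum>i\<in>T. (?v $ i - y $ i)\<^sup>2) = (\<Sum>k<r. (?v $ e k - y $ e k)\<^sup>2)"
    using sum.reindex_bij_betw[OF assms, of "\<lambda>i. (?v $ i - y $ i)\<^sup>2"] by simp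
  also have "\<dots> = (L2_set (\<lambda>k. u k - y $ e k) {..<r})\<^sup>2"
    using embed_vec_nth_inside[OF assms] by (simp add: L2_set_def sum_nonneg)
  finally show ?thesis
    by (cases "R ?v") (simp_all add: prox_objective_def restricted_objective_def distrib_left)
qed

lemma embed_restricted_minimizer:
  fixes R :: "real^'n \<Rightarrow> ereal"
  assumes "permutation_invariant R" and "0 \<le> lam"
    and T: "admissible_support R r y T" and e: "bij_betw e {..<r} T"
    and u: "u \<in> restricted_minimizers R lam r e y"
  shows "embed_vec r e u \<in> argmin_on (prox_objective R lam y) (sparse_dom R r)"
proof -
  let ?c = "ereal (lam * (\<Sum>i\<in>-T. (y $ i)\<^sup>2))"
  have fin: "restricted_objective R lam r e y u < \<infinity>"
    and min: "\<And>v. v \<in> vec_space r \<Longrightarrow> restricted_objective R lam r e y u \<le> restricted_objective R lam r e y v"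
    using u by (auto simp: restricted_minimizers_def argmin_on_def is_arg_min_def not_less)
  \<comment> \<open>Membership in \<open>argmin_on\<close> includes a value below infinity, which
    puts the embedded point into the domain of \<open>R\<close>.\<close>
  have dom: "embed_vec r e u \<in> sparse_dom R r"
    using fin nnz_embed_vec_le[OF e] by (auto simp: sparse_dom_def edom_def restricted_objective_def)
  have "prox_objective R lam y (embed_vec r e u) \<le> prox_objective R lam y x"
    if x: "x \<in> sparse_dom R r" for x
  proof -
    obtain z where z: "\<And>i. i \<notin> T \<Longrightarrow> z $ i = 0"
      "prox_objective R lam y z \<le> prox_objective R lam y x"
      using exists_dominating_point_supported_on[OF assms(1-3) x] by auto
    \<comment> \<open>The coordinates of the dominating point \<open>z\<close> are a competitor of
      \<open>u\<close> in the restricted problem.\<close>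
    let ?v = "restrict (\<lambda>k. z $ e k) {..<r}"
    have "prox_objective R lam y (embed_vec r e u) = ?c + restricted_objective R lam r e y u"
      by (rule prox_objective_embed_vec[OF e])
    also have "\<dots> \<le> ?c + restricted_objective R lam r e y ?v"
      by (intro add_left_mono min) (simp add: vec_space_def)
    also have "\<dots> = prox_objective R lam y z"
      using prox_objective_embed_vec[OF e, of R lam y ?v] embed_vec_restrict[OF e z(1)] by simp
    finally show ?thesis
      using z(2) by simp
  qed
  moreover have "prox_objective R lam y (embed_vec r e u) < \<infinity>"
    using fin prox_objective_embed_vec[OF e, of R lam y u] by simp
  ultimately show ?thesis
    using dom by (auto simp: argmin_on_def is_arg_min_def not_less)
qed

subsection \<open>Existence of restricted minimizers\<close>

text \<open>Sublevel sets are closed, being slices of the epigraph, and those at real levels above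
  the infimum have the finite intersection property on \<open>K\<close>. A common point attains the
  infimum, which may a priori be infinite.\<close>

lemma closed_epigraph_attains_inf:
  fixes g :: "'a::t2_space \<Rightarrow> ereal"
  assumes g: "closed (ereal_epigraph g)" and K: "compact K" "K \<noteq> {}"
  shows "\<exists>x\<in>K. \<forall>z\<in>K. g x \<le> g z"
proof (cases "\<exists>z\<in>K. g z < \<infinity>")
  case False
  then show ?thesis
    using K by (metis ereal_infty_less(1) ex_in_conv ereal_less_eq(1))
next
  case True
  define m where "m = (INF z\<in>K. g z)"
  define L where "L t = {x. g x \<le> ereal t}" for t
  have closed: "closed (L t)" for t
  proof -
    have "L t = (\<lambda>x. (x, t)) -` ereal_epigraph g"
      by (auto simp: L_def ereal_epigraph_def)
    then show ?thesis
      using g by (simp add: closed_vimage continuous_intros)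
  qed
  have "K \<inter> (\<Inter>t\<in>{t. m < ereal t}. L t) \<noteq> {}"
  proof (rule compact_imp_fip_image[OF K(1)])
    fix F assume F: "finite F" "F \<subseteq> {t. m < ereal t}"
    show "K \<inter> (\<Inter>t\<in>F. L t) \<noteq> {}"
    proof (cases "F = {}")
      case True
      then show ?thesis using K by simp
    next
      case False
      \<comment> \<open>Sublevel sets are nested, so a point below the smallest level lies in all of
        them.\<close>
      then have "m < ereal (Min F)"
        using F Min_in[of F] by blast
      then obtain z where "z \<in> K" "g z < ereal (Min F)"
        unfolding m_def by (auto simp: INF_less_iff)
      moreover have "ereal (Min F) \<le> ereal t" if "t \<in> F" for t
        using F that by simp
      ultimately have "z \<in> K \<inter> (\<Inter>t\<in>F. L t)"
        unfolding L_def by (auto intro: order_trans less_imp_le)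
      then show ?thesis by blast
    qed
  qed (use closed in auto)
  then obtain x where x: "x \<in> K" "\<And>t. m < ereal t \<Longrightarrow> g x \<le> ereal t"
    unfolding L_def by auto
  have "g x \<le> m"
  proof (rule ccontr)
    assume "\<not> g x \<le> m"
    then obtain t where "m < ereal t" "ereal t < g x"
      using ereal_dense2[of m "g x"] by (auto simp: not_le)
    then show False
      using x(2)[of t] by simp
  qed
  then have "g x \<le> g z" if "z \<in> K" for z
    using that unfolding m_def by (meson INF_lower order_trans)
  then show ?thesis
    using x(1) by blast
qed

text \<open>\<open>R\<close> is bounded below on the unit ball around \<open>x0\<close>. A steeper
  than linear descent farther out would, by convexity along the segment from \<open>x0\<close>,
  violate that bound on the unit sphere.\<close>

lemma closed_convex_ge_linear:
  fixes R :: "'a::euclidean_space \<Rightarrow> ereal"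
  assumes proper: "proper_fun R" and conv: "convex (ereal_epigraph R)"
    and closed: "closed (ereal_epigraph R)" and x0: "R x0 < \<infinity>"
  shows "\<exists>C\<ge>0. \<forall>x. 1 < dist x0 x \<longrightarrow> ereal (- C * dist x0 x) \<le> R x"
proof -
  have notinf: "R x \<noteq> -\<infinity>" for x
    using proper by (auto simp: proper_fun_def)
  obtain c where c: "R x0 = ereal c"
    using x0 notinf[of x0] by (cases "R x0") auto
  have "\<exists>x1\<in>cball x0 1. \<forall>z\<in>cball x0 1. R x1 \<le> R z"
    by (rule closed_epigraph_attains_inf[OF closed]) auto
  then obtain x1 where x1: "\<And>z. z \<in> cball x0 1 \<Longrightarrow> R x1 \<le> R z"
    by blast
  then obtain m where m: "R x1 = ereal m"
    using x1[of x0] c notinf[of x1] by (cases "R x1") auto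
  define C where "C = \<bar>m\<bar> + \<bar>c\<bar>"
  have "ereal (- C * dist x0 x) \<le> R x" if t: "1 < dist x0 x" for x
  proof (cases "R x")
    case (real q)
    define t where "t = dist x0 x"
    have t1: "1 < t"
      using that by (simp add: t_def)
    \<comment> \<open>The point of the segment from \<open>x0\<close> to \<open>x\<close> at
      distance 1 from \<open>x0\<close>. Solving \<open>m \<le> (1 - 1 / t) * c + 1 / t * q\<close>
      for \<open>q\<close> then yields the constant \<open>C\<close>.\<close>
    define z where "z = (1 - 1 / t) *\<^sub>R x0 + (1 / t) *\<^sub>R x"
    have "(1 - 1 / t) *\<^sub>R (x0, c) + (1 / t) *\<^sub>R (x, q) \<in> ereal_epigraph R"
      using conv c real t1 by (intro convexD) (auto simp: ereal_epigraph_def field_simps)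
    then have "R z \<le> ereal ((1 - 1 / t) * c + 1 / t * q)"
      by (simp add: ereal_epigraph_def z_def)
    moreover have "R x1 \<le> R z"
    proof (rule x1)
      have "x0 - z = (1 / t) *\<^sub>R (x0 - x)"
        by (simp add: z_def algebra_simps)
      then have "dist x0 z = 1 / t * norm (x0 - x)"
        using t1 by (simp add: dist_norm)
      then show "z \<in> cball x0 1"
        using t1 by (simp add: t_def dist_norm)
    qed
    ultimately have "ereal m \<le> ereal ((1 - 1 / t) * c + 1 / t * q)"
      using m by (metis order_trans)
    then have "t * m \<le> (t - 1) * c + q"
      using t1 by (simp add: field_simps)
    moreover have "(t - 1) * c \<le> t * \<bar>c\<bar>"
      using t1 mult_left_mono[OF abs_ge_self, of "t - 1" c] by (simp add: algebra_simps)
    moreover have "- (t * \<bar>m\<bar>) \<le> t * m"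
      using t1 by (metis abs_ge_minus_self abs_mult abs_of_pos less_trans minus_le_iff zero_less_one)
    ultimately have "- C * t \<le> q"
      by (simp add: C_def algebra_simps)
    then show ?thesis
      using real by (simp add: t_def)
  qed (use notinf in auto)
  then show ?thesis
    by (intro exI[of _ C]) (auto simp: C_def)
qed

text \<open>The quadratic term outgrows the at most linear descent of \<open>R\<close>, so far
  points are worse than \<open>x0\<close>.\<close>

lemma prox_objective_coercive:
  fixes R :: "real^'n \<Rightarrow> ereal"
  assumes "proper_fun R" and "convex (ereal_epigraph R)" and "closed (ereal_epigraph R)"
    and x0: "R x0 < \<infinity>" and lam: "0 < lam"
  shows "\<exists>\<rho>\<ge>0. \<forall>x. x \<notin> cball x0 \<rho> \<longrightarrow> prox_objective R lam y x0 < prox_objective R lam y x"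
proof -
  obtain c where c: "R x0 = ereal c"
    using x0 assms(1) by (cases "R x0") (auto simp: proper_fun_def)
  obtain C where C: "0 \<le> C" "\<And>x. 1 < dist x0 x \<Longrightarrow> ereal (- C * dist x0 x) \<le> R x"
    using closed_convex_ge_linear[OF assms(1-4)] by auto
  define d where "d = norm (x0 - y)"
  \<comment> \<open>A distance \<open>t\<close> beyond \<open>\<rho>\<close> exceeds 1, as the
    linear bound needs, exceeds \<open>d\<close>, so that the triangle inequality may be squared,
    and gives \<open>lam * t - 2 * lam * d - C > \<bar>c\<bar>\<close>.\<close>
  define \<rho> where "\<rho> = 1 + d + (2 * lam * d + C + \<bar>c\<bar>) / lam"
  have d: "0 \<le> d"
    by (simp add: d_def)
  have "0 \<le> (2 * lam * d + C + \<bar>c\<bar>) / lam"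
    using lam C d by simp
  then have \<rho>: "1 + d \<le> \<rho>"
    by (simp add: \<rho>_def)
  have "prox_objective R lam y x0 < prox_objective R lam y x" if x: "x \<notin> cball x0 \<rho>" for x
  proof -
    define t where "t = dist x0 x"
    have t: "\<rho> < t"
      using x by (simp add: t_def)
    have "t \<le> norm (x - y) + d"
      using dist_triangle[of x0 x y] by (simp add: t_def d_def dist_norm norm_minus_commute)
    then have "(t - d)\<^sup>2 \<le> (norm (x - y))\<^sup>2"
      using t \<rho> by (intro power_mono) auto
    then have sq: "lam * (t - d)\<^sup>2 \<le> lam * (norm (x - y))\<^sup>2"
      using lam by simp
    have "(2 * lam * d + C + \<bar>c\<bar>) / lam < t"
      using t d by (simp add: \<rho>_def)
    then have "\<bar>c\<bar> < lam * t - 2 * lam * d - C"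
      using lam by (simp add: field_simps)
    \<comment> \<open>The factor is positive, since it exceeds \<open>\<bar>c\<bar>\<close>, and
      \<open>t\<close> is above 1; completing the square below turns the product into the difference
      wanted.\<close>
    moreover from this have "1 * (lam * t - 2 * lam * d - C) \<le> t * (lam * t - 2 * lam * d - C)"
      using t \<rho> d by (intro mult_right_mono) auto
    ultimately have "c < t * (lam * t - 2 * lam * d - C)"
      using abs_ge_self[of c] by simp
    also have "\<dots> = lam * (t - d)\<^sup>2 - lam * d\<^sup>2 - C * t"
      by (simp add: power2_eq_square algebra_simps)
    finally have "lam * d\<^sup>2 + c < lam * (norm (x - y))\<^sup>2 + - C * t"
      using sq by linarith
    then have "prox_objective R lam y x0 < ereal (lam * (norm (x - y))\<^sup>2) + ereal (- C * t)"
      by (simp add: prox_objective_def c d_def)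
    also have "\<dots> \<le> prox_objective R lam y x"
      unfolding prox_objective_def using C(2)[of x] t \<rho> d
      by (intro add_left_mono) (auto simp: t_def)
    finally show ?thesis .
  qed
  then show ?thesis
    using \<rho> d by (intro exI[of _ \<rho>]) auto
qed

text \<open>Adding a continuous real function shears the epigraph vertically, so the new epigraph is
  a continuous preimage of the old one.\<close>

lemma closed_epigraph_prox_objective:
  fixes R :: "real^'n \<Rightarrow> ereal"
  assumes "closed (ereal_epigraph R)"
  shows "closed (ereal_epigraph (prox_objective R lam y))"
proof -
  have "prox_objective R lam y x \<le> ereal t \<longleftrightarrow> R x \<le> ereal (t - lam * (norm (x - y))\<^sup>2)" for x t
    by (cases "R x") (auto simp: prox_objective_def)
  then have "ereal_epigraph (prox_objective R lam y) =
      (\<lambda>(x, t). (x, t - lam * (norm (x - y))\<^sup>2)) -` ereal_epigraph R"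
    by (auto simp: ereal_epigraph_def)
  moreover have "continuous_on UNIV (\<lambda>(x, t). (x, t - lam * (norm (x - y))\<^sup>2))"
    by (auto simp: case_prod_unfold intro!: continuous_intros)
  ultimately show ?thesis
    using assms by (simp add: closed_vimage)
qed

lemma restricted_minimizers_nonempty:
  fixes R :: "real^'n \<Rightarrow> ereal"
  assumes "proper_fun R" and "convex (ereal_epigraph R)" and closed: "closed (ereal_epigraph R)"
    and lam: "0 < lam" and e: "bij_betw e {..<r} T"
    and x0: "R x0 < \<infinity>" "\<And>i. i \<notin> T \<Longrightarrow> x0 $ i = 0"
  shows "restricted_minimizers R lam r e y \<noteq> {}"
proof -
  let ?P = "prox_objective R lam y"
  obtain \<rho> where \<rho>: "0 \<le> \<rho>" "\<And>x. x \<notin> cball x0 \<rho> \<Longrightarrow> ?P x0 < ?P x"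
    using prox_objective_coercive[OF assms(1-3) x0(1) lam] by blast
  \<comment> \<open>The minimum is sought in the subspace of vectors supported on \<open>T\<close>,
    where compactness of balls in \<open>real^'n\<close> is at hand, and is pulled back to
    coordinates afterwards.\<close>
  define V :: "(real^'n) set" where "V = (\<Inter>i\<in>-T. {x. x $ i = 0})"
  have "closed V"
    unfolding V_def by (intro closed_INT ballI closed_Collect_eq continuous_intros)
  then have "compact (V \<inter> cball x0 \<rho>)"
    by (intro closed_Int_compact compact_cball)
  moreover have x0_V: "x0 \<in> V \<inter> cball x0 \<rho>"
    using x0(2) \<rho>(1) by (simp add: V_def)
  ultimately have "\<exists>x\<in>V \<inter> cball x0 \<rho>. \<forall>z\<in>V \<inter> cball x0 \<rho>. ?P x \<le> ?P z"
    by (intro closed_epigraph_attains_inf closed_epigraph_prox_objective closed) auto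
  then obtain x where x: "x \<in> V" "\<And>z. z \<in> V \<inter> cball x0 \<rho> \<Longrightarrow> ?P x \<le> ?P z"
    by blast
  have le: "?P x \<le> ?P z" if "z \<in> V" for z
  proof (cases "z \<in> cball x0 \<rho>")
    case True
    then show ?thesis
      using x(2)[of z] that by blast
  next
    case False
    then show ?thesis
      \<comment> \<open>Outside the ball coercivity makes \<open>z\<close> worse than
        \<open>x0\<close>, which itself competes inside.\<close>
      using x(2)[OF x0_V] \<rho>(2) by (meson less_imp_le order_trans)
  qed
  define u where "u = restrict (\<lambda>k. x $ e k) {..<r}"
  have x_eq: "embed_vec r e u = x"
    unfolding u_def using x(1) by (intro embed_vec_restrict[OF e]) (simp add: V_def)
  have "restricted_objective R lam r e y u \<le> restricted_objective R lam r e y v" for v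
  proof -
    have "embed_vec r e v \<in> V"
      using embed_vec_nth_outside[OF e] by (simp add: V_def)
    \<comment> \<open>The constant between the two objectives is a real number and therefore cancels
      in \<open>ereal\<close>.\<close>
    from le[OF this] show ?thesis
      unfolding x_eq[symmetric] prox_objective_embed_vec[OF e] by (simp add: ereal_add_le_add_iff)
  qed
  moreover have "restricted_objective R lam r e y u < \<infinity>"
  proof -
    have "?P x \<le> ?P x0"
      using x0_V by (intro le) simp
    also have "\<dots> < \<infinity>"
      using x0(1) by (simp add: prox_objective_def)
    finally show ?thesis
      unfolding x_eq[symmetric] prox_objective_embed_vec[OF e] by simp
  qed
  moreover have "u \<in> vec_space r"
    by (simp add: u_def vec_space_def)
  ultimately have "u \<in> restricted_minimizers R lam r e y"
    by (auto simp: restricted_minimizers_def argmin_on_def is_arg_min_def not_less)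
  then show ?thesis
    by blast
qed

text \<open>Greedy choice: add an index of largest weight outside \<open>T\<close>; the earlier
  members already dominate everything that remains outside.\<close>

lemma exists_top_indices:
  fixes w :: "'n::finite \<Rightarrow> real"
  assumes "r \<le> CARD('n)"
  shows "\<exists>T. top_indices r w T"
  using assms
proof (induction r)
  case 0
  then show ?case
    by (intro exI[of _ "{}"]) (simp add: top_indices_def)
next
  case (Suc r)
  then obtain T where T: "top_indices r w T"
    by auto
  have "T \<noteq> UNIV"
    using T Suc.prems by (auto simp: top_indices_def)
  then have "-T \<noteq> {}"
    by auto
  have "arg_min_on (\<lambda>i. - w i) (-T) \<in> -T" "\<And>j. j \<in> -T \<Longrightarrow> w j \<le> w (arg_min_on (\<lambda>i. - w i) (-T))"
    using \<open>-T \<noteq> {}\<close> arg_min_if_finite(1)[of "-T" "\<lambda>i. - w i"] arg_min_least[of "-T" _ "\<lambda>i. - w i"]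
    by auto
  then obtain a where "a \<in> -T" "\<And>j. j \<in> -T \<Longrightarrow> w j \<le> w a"
    by blast
  then show ?case
    using T by (intro exI[of _ "insert a T"]) (auto simp: top_indices_def)
qed

section \<open>The sparse proximal step and the oracle property\<close>

theorem lemma1:
  fixes f :: "real^'n \<Rightarrow> real" and R :: "real^'n \<Rightarrow> ereal"
    and \<alpha> :: real and s r :: nat
  assumes "convex_on UNIV f" and "closed (epigraph UNIV f)"
    and "proper_fun R" and "convex (ereal_epigraph R)" and "closed (ereal_epigraph R)"
    and "minimizers f R \<noteq> {}"
    and "0 < \<alpha>" and "quadratic_growth f R \<alpha>"
    and "permutation_invariant R"
    and "edom R \<subseteq> nonneg_orthant \<or> sign_invariant R"
    and "s \<le> r" and "r \<le> CARD('n)"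
  shows "(\<forall>y lam T e u. 0 < lam \<longrightarrow> admissible_support R r y T \<longrightarrow> bij_betw e {..<r} T \<longrightarrow>
            u \<in> restricted_minimizers R lam r e y \<longrightarrow>
            embed_vec r e u \<in> argmin_on (prox_objective R lam y) (sparse_dom R r)) \<and>
         ((\<forall>x\<in>minimizers f R. nnz x \<le> s) \<longrightarrow>
            (\<forall>y lam T e. 0 < lam \<longrightarrow> admissible_support R r y T \<longrightarrow> bij_betw e {..<r} T \<longrightarrow>
               restricted_minimizers R lam r e y \<noteq> {}) \<and>
            (\<exists>A. sparse_prox_map R r A) \<and>
            (\<forall>A. sparse_prox_map R r A \<longrightarrow> weak_proximal_oracle f R A))"
proof -
  have part1: "embed_vec r e u \<in> argmin_on (prox_objective R lam y) (sparse_dom R r)"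
    if "0 < lam" "admissible_support R r y T" "bij_betw e {..<r} T"
      "u \<in> restricted_minimizers R lam r e y" for y lam T e u
    using embed_restricted_minimizer[OF assms(9) less_imp_le] that by blast
  have part2: "restricted_minimizers R lam r e y \<noteq> {}"
    if sparse: "\<forall>x\<in>minimizers f R. nnz x \<le> s" and lam: "0 < lam"
      and T: "admissible_support R r y T" and e: "bij_betw e {..<r} T"
    for y lam T e
  proof -
    obtain x where x: "x \<in> minimizers f R"
      using assms(6) by blast
    then have "x \<in> sparse_dom R r"
      using sparse assms(11)
      by (auto simp: minimizers_def argmin_on_def objective_def sparse_dom_def edom_def)
    \<comment> \<open>A sparse minimizer of the objective, moved into \<open>T\<close>, supplies the
      domain point supported on \<open>T\<close> from which existence follows.\<close>
    then obtain z where "\<And>i. i \<notin> T \<Longrightarrow> z $ i = 0" "R z = R x" "R x < \<infinity>"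
      using exists_dominating_point_supported_on[OF assms(9) less_imp_le[OF lam] T]
      by (auto simp: sparse_dom_def edom_def)
    then show ?thesis
      using restricted_minimizers_nonempty[OF assms(3-5) lam e] by metis
  qed
  have part3: "\<exists>A. sparse_prox_map R r A" if sparse: "\<forall>x\<in>minimizers f R. nnz x \<le> s"
  proof -
    have "\<exists>x. sparse_prox_output R r y lam x" if lam: "0 < lam" for y lam
    proof -
      obtain T where T: "admissible_support R r y T"
        using assms(10) exists_top_indices[OF assms(12)] unfolding admissible_support_def by metis
      then have "card T = r"
        by (auto simp: admissible_support_def top_indices_def)
      then obtain e where "bij_betw e {..<r} T"
        using ex_bij_betw_nat_finite[of T] by (auto simp: atLeast0LessThan)
      then show ?thesis
        using T part2[OF sparse lam T] unfolding sparse_prox_output_def by blast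
    qed
    then have "\<exists>A. \<forall>y lam. 0 < lam \<longrightarrow> sparse_prox_output R r y lam (A y lam)"
      by (intro choice allI) auto
    then obtain A where A: "\<And>y lam. 0 < lam \<Longrightarrow> sparse_prox_output R r y lam (A y lam)"
      by blast
    obtain x0 where "x0 \<in> edom R"
      using assms(3) by (auto simp: proper_fun_def edom_def)
    \<comment> \<open>At parameter 0 the map only has to stay in the domain, so a fixed point
      \<open>x0\<close> of it is returned.\<close>
    then have "sparse_prox_map R r (\<lambda>y lam. if 0 < lam then A y lam else x0)"
      using A by (simp add: sparse_prox_map_def)
    then show ?thesis
      by blast
  qed
  have part4: "weak_proximal_oracle f R A"
    if sparse: "\<forall>x\<in>minimizers f R. nnz x \<le> s" and A: "sparse_prox_map R r A" for A
  proof -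
    have min: "A y lam \<in> argmin_on (prox_objective R lam y) (sparse_dom R r)" if "0 < lam" for y lam
      using A part1[OF that] that unfolding sparse_prox_map_def sparse_prox_output_def by metis
    have "A y lam \<in> edom R" if "0 \<le> lam" for y lam
    proof (cases "lam = 0")
      case True
      then show ?thesis
        using A by (simp add: sparse_prox_map_def)
    next
      case False
      then show ?thesis
        using min[of lam y] that by (auto simp: argmin_on_def is_arg_min_def sparse_dom_def)
    qed
    moreover have "prox_objective R lam y (A y lam) \<le> prox_objective R lam y x"
      if lam: "0 < lam" and x: "x \<in> minimizers f R" for y lam x
    proof -
      \<comment> \<open>By \<open>s \<le> r\<close>, each minimizer competes in the sparse problem
        that \<open>A y lam\<close> solves, which is the oracle inequality.\<close>
      have "x \<in> sparse_dom R r"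
        using x sparse assms(11)
        by (auto simp: minimizers_def argmin_on_def objective_def sparse_dom_def edom_def)
      then show ?thesis
        using min[OF lam, of y] by (auto simp: argmin_on_def is_arg_min_def not_less)
    qed
    ultimately show ?thesis
      by (simp add: weak_proximal_oracle_def)
  qed
  show ?thesis
    using part1 part2 part3 part4 by blast
qed

end
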